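(* Let $n\ge1$, let $e_0,e_1,\dots,e_n$ be the standard basis of $\mathbb R^{n+1}$, and let $B_i=(e_0e_i^{\mathsf T}+e_ie_0^{\mathsf T})/\sqrt2$ for $1\le i\le n$. Then every signing has norm $\bigl\|\sum_{i=1}^ns_iB_i\bigr\|=\sqrt{n/2}$, $s\in\{-1,1\}^n$, and $$\frac{(\sqrt n-1)^2}{2}\le\nu(B)\le\frac n2.$$ Consequently a matrix Komlós statement based only on $\max_i\|B_i\|_{\mathrm F}\le1$ is false: there is no universal constant $K$ such that every finite family of real symmetric matrices $B_1,\dots,B_n$ of equal size (in any dimension) with $\max_i\|B_i\|_{\mathrm F}\le1$ satisfies $\min_{s\in\{-1,1\}^n}\|\sum_is_iB_i\|\le K$.
   Context: $\|\cdot\|$ is the operator norm and $\|\cdot\|_{\mathrm F}$ the Frobenius norm. For a family $B=(B_i)$ of real symmetric $d\times d$ matrices, $\nu(B)=\min_{U\in O(d)}\|\sum_i(B_i-P_UB_i)^2\|$, where $P_U(H)=U\,\mathrm{diag}(U^{\mathsf T}HU)U^{\mathsf T}$ and $\mathrm{diag}$ keeps only the diagonal entries. *)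

theory Defs
  imports Complex_Main "HOL-Library.FuncSet" "Jordan_Normal_Form.Matrix"
begin

text \<open>Dimensions vary inside the statement, so matrices are the dimension-carrying
  \<^typ>\<open>real mat\<close>; indices of vectors and matrices start at 0.\<close>

definition l2_norm :: "real vec \<Rightarrow> real" where
  "l2_norm v = sqrt (v \<bullet> v)"

definition op_norm :: "real mat \<Rightarrow> real" where
  "op_norm A = (SUP v \<in> {v \<in> carrier_vec (dim_col A). l2_norm v \<le> 1}. l2_norm (A *\<^sub>v v))"

definition frob_norm :: "real mat \<Rightarrow> real" where
  "frob_norm A = sqrt (\<Sum>i<dim_row A. \<Sum>j<dim_col A. (A $$ (i, j))\<^sup>2)"

definition sym_mats :: "nat \<Rightarrow> real mat set" where
  "sym_mats d = {A \<in> carrier_mat d d. A\<^sup>T = A}"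

definition orthogonal_group :: "nat \<Rightarrow> real mat set" where
  "orthogonal_group d = {U \<in> carrier_mat d d. U\<^sup>T * U = 1\<^sub>m d \<and> U * U\<^sup>T = 1\<^sub>m d}"

text \<open>The type of matrices of all dimensions has no zero element, so \<^const>\<open>sum\<close> is not
  available for it. The sum of a family of d by d matrices is taken entrywise.\<close>

definition mat_sum :: "nat \<Rightarrow> ('i \<Rightarrow> real mat) \<Rightarrow> 'i set \<Rightarrow> real mat" where
  "mat_sum d B I = mat d d (\<lambda>(r, c). \<Sum>i\<in>I. B i $$ (r, c))"

definition diag_part :: "real mat \<Rightarrow> real mat" where
  "diag_part A = mat (dim_row A) (dim_col A) (\<lambda>(i, j). if i = j then A $$ (i, j) else 0)"

definition pinching :: "real mat \<Rightarrow> real mat \<Rightarrow> real mat" where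
  "pinching U H = U * diag_part (U\<^sup>T * H * U) * U\<^sup>T"

definition mat_square :: "real mat \<Rightarrow> real mat" where
  "mat_square A = A * A"

text \<open>\<^const>\<open>Min\<close> is for finite sets only, and the orthogonal group is infinite for d at least 2.
  The minimum is therefore expressed by \<^const>\<open>Least\<close>, which for a set of reals denotes an element
  of the set that is a lower bound of it. It exists because the orthogonal group is compact and the
  objective is continuous.\<close>

definition nu :: "nat \<Rightarrow> ('i \<Rightarrow> real mat) \<Rightarrow> 'i set \<Rightarrow> real" where
  "nu d B I = (LEAST x. x \<in>
     (\<lambda>U. op_norm (mat_sum d (\<lambda>i. mat_square (B i - pinching U (B i))) I)) ` orthogonal_group d)"

definition signings :: "nat \<Rightarrow> (nat \<Rightarrow> real) set" where
  "signings n = {1..n} \<rightarrow>\<^sub>E {-1, 1}"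

definition signed_sum :: "nat \<Rightarrow> nat \<Rightarrow> (nat \<Rightarrow> real) \<Rightarrow> (nat \<Rightarrow> real mat) \<Rightarrow> real mat" where
  "signed_sum d n s B = mat_sum d (\<lambda>i. s i \<cdot>\<^sub>m B i) {1..n}"

definition outer_prod :: "real vec \<Rightarrow> real vec \<Rightarrow> real mat" where
  "outer_prod u v = mat (dim_vec u) (dim_vec v) (\<lambda>(i, j). u $ i * v $ j)"

definition star_mat :: "nat \<Rightarrow> nat \<Rightarrow> real mat" where
  "star_mat n i = (1 / sqrt 2) \<cdot>\<^sub>m
     (outer_prod (unit_vec (n + 1) 0) (unit_vec (n + 1) i) +
      outer_prod (unit_vec (n + 1) i) (unit_vec (n + 1) 0))"

end

theory Submission
  imports Defs "HOL-Analysis.L2_Norm" "HOL-Analysis.Convex"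
begin

text \<open>
  For a vector \<open>w\<close> orthogonal to \<open>e\<^sub>0\<close>, the matrix \<open>e\<^sub>0 w\<^sup>T + w e\<^sub>0\<^sup>T\<close> acts as \<open>\<bar>w\<bar>\<close> times a partial
  isometry, so its norm depends on \<open>w\<close> only through its length. A signed sum of the \<open>B\<^sub>i\<close> is such a
  matrix with \<open>w = s / sqrt 2\<close>, and all sign vectors have length \<open>sqrt n\<close>: no signing can make use of
  cancellation. Each \<open>B\<^sub>i\<close> has Frobenius norm 1, so the unbounded norms \<open>sqrt (n / 2)\<close> also refute the
  Frobenius-norm variant of the Komlos statement.

  For the lower bound on \<open>\<nu>\<close>, fix an orthogonal \<open>U\<close> with columns \<open>u\<^sub>k\<close> and write \<open>P\<^sub>i\<close> for the pinching
  of \<open>B\<^sub>i\<close>. The norm of \<open>M = \<Sum>\<^sub>i (B\<^sub>i - P\<^sub>i)\<^sup>2\<close> is at least its entry at \<open>(0, 0)\<close>, which is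
  \<open>\<Sum>\<^sub>i \<bar>(B\<^sub>i - P\<^sub>i) e\<^sub>0\<bar>\<^sup>2\<close> because \<open>B\<^sub>i - P\<^sub>i\<close> is symmetric. By Minkowski's inequality the square root
  of this sum is at least the difference of the square roots of \<open>\<Sum>\<^sub>i \<bar>B\<^sub>i e\<^sub>0\<bar>\<^sup>2 = n / 2\<close> and
  \<open>\<Sum>\<^sub>i \<bar>P\<^sub>i e\<^sub>0\<bar>\<^sup>2\<close>. The latter sum is at most \<open>1 / 2\<close>
  (\<open>pinched_first_column_bound\<close>): since \<open>u\<^sub>k\<^sup>T B\<^sub>i u\<^sub>k = sqrt 2 u\<^sub>k(0) u\<^sub>k(i)\<close>, it equals
  \<open>\<Sum>\<^sub>k 2 a\<^sub>k\<^sup>2 (1 - a\<^sub>k)\<close> with \<open>a\<^sub>k = u\<^sub>k(0)\<^sup>2\<close>, where \<open>\<Sum>\<^sub>k a\<^sub>k = 1\<close> and \<open>2 a (1 - a) \<le> 1 / 2\<close>.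

  For the upper bound, \<open>U = 1\<close> pinches every \<open>B\<^sub>i\<close> to 0, and \<open>\<Sum>\<^sub>i B\<^sub>i\<^sup>2\<close> is diagonal with entries
  \<open>n / 2, 1 / 2, \<dots>, 1 / 2\<close>.

  Both bounds hold for individual \<open>U\<close>; they transfer to \<open>\<nu>\<close> because the minimum is attained
  (\<open>nu_attained\<close>). This is a compactness argument in terms of entrywise convergence: a sequence of
  orthogonal matrices has a subsequence that converges to an orthogonal matrix, and along it the
  objective is lower semicontinuous.
\<close>

section \<open>The operator norm\<close>

lemma l2_norm_eq_L2_set:
  assumes "v \<in> carrier_vec d"
  shows "l2_norm v = L2_set (\<lambda>i. v $ i) {0..<d}"
  using assms by (simp add: l2_norm_def L2_set_def scalar_prod_def power2_eq_square)

lemma l2_norm_nonneg: "0 \<le> l2_norm v"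
  using l2_norm_eq_L2_set[of v "dim_vec v"] by (simp add: carrier_vec_dim_vec)

lemma mult_mat_vec_entry:
  assumes "A \<in> carrier_mat m d" "v \<in> carrier_vec d" "r < m"
  shows "(A *\<^sub>v v) $ r = (\<Sum>j = 0..<d. A $$ (r, j) * v $ j)"
  using assms by (simp add: scalar_prod_def)

lemma mult_mat_entry:
  assumes "A \<in> carrier_mat m d" "B \<in> carrier_mat d p" "r < m" "c < p"
  shows "(A * B) $$ (r, c) = (\<Sum>k = 0..<d. A $$ (r, k) * B $$ (k, c))"
  using assms by (simp add: scalar_prod_def)

text \<open>Without this bound the supremum that defines the operator norm would be an unspecified real.\<close>
lemma bdd_above_l2_norm_image:
  assumes A: "A \<in> carrier_mat m d"
  shows "bdd_above ((\<lambda>v. l2_norm (A *\<^sub>v v)) ` {v \<in> carrier_vec (dim_col A). l2_norm v \<le> 1})"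
proof (rule bdd_aboveI2)
  fix v assume "v \<in> {v \<in> carrier_vec (dim_col A). l2_norm v \<le> 1}"
  then have v: "v \<in> carrier_vec d" and le: "l2_norm v \<le> 1" using A by auto
  have le': "\<bar>v $ j\<bar> \<le> 1" if "j \<in> {0..<d}" for j
  proof -
    have "\<bar>v $ j\<bar> \<le> L2_set (\<lambda>j. \<bar>v $ j\<bar>) {0..<d}"
      using that by (intro member_le_L2_set) auto
    also have "\<dots> = l2_norm v" using l2_norm_eq_L2_set[OF v] by (simp add: L2_set_def)
    finally show ?thesis using le by simp
  qed
  have "l2_norm (A *\<^sub>v v) = L2_set (\<lambda>r. (A *\<^sub>v v) $ r) {0..<m}"
    using A v by (intro l2_norm_eq_L2_set) auto
  also have "\<dots> \<le> (\<Sum>r = 0..<m. \<bar>(A *\<^sub>v v) $ r\<bar>)" by (rule L2_set_le_sum_abs)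
  also have "\<dots> \<le> (\<Sum>r = 0..<m. \<Sum>j = 0..<d. \<bar>A $$ (r, j)\<bar>)"
  proof (rule sum_mono)
    fix r assume "r \<in> {0..<m}"
    then have "\<bar>(A *\<^sub>v v) $ r\<bar> = \<bar>\<Sum>j = 0..<d. A $$ (r, j) * v $ j\<bar>"
      using mult_mat_vec_entry[OF A v] by simp
    also have "\<dots> \<le> (\<Sum>j = 0..<d. \<bar>A $$ (r, j) * v $ j\<bar>)" by (rule sum_abs)
    also have "\<dots> \<le> (\<Sum>j = 0..<d. \<bar>A $$ (r, j)\<bar>)"
      using le' by (intro sum_mono) (simp add: abs_mult mult_left_le)
    finally show "\<bar>(A *\<^sub>v v) $ r\<bar> \<le> (\<Sum>j = 0..<d. \<bar>A $$ (r, j)\<bar>)" .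
  qed
  finally show "l2_norm (A *\<^sub>v v) \<le> (\<Sum>r = 0..<m. \<Sum>j = 0..<d. \<bar>A $$ (r, j)\<bar>)" .
qed

lemma l2_norm_mult_le_op_norm:
  assumes "A \<in> carrier_mat m d" "v \<in> carrier_vec d" "l2_norm v \<le> 1"
  shows "l2_norm (A *\<^sub>v v) \<le> op_norm A"
  unfolding op_norm_def
  using assms by (intro cSUP_upper bdd_above_l2_norm_image[OF assms(1)]) auto

lemma op_norm_least:
  assumes "A \<in> carrier_mat m d"
    and "\<And>v. v \<in> carrier_vec d \<Longrightarrow> l2_norm v \<le> 1 \<Longrightarrow> l2_norm (A *\<^sub>v v) \<le> c"
  shows "op_norm A \<le> c"
  unfolding op_norm_def
proof (rule cSUP_least)
  have "0\<^sub>v (dim_col A) \<in> {v \<in> carrier_vec (dim_col A). l2_norm v \<le> 1}"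
    by (simp add: l2_norm_def)
  then show "{v \<in> carrier_vec (dim_col A). l2_norm v \<le> 1} \<noteq> {}" by blast
qed (use assms in auto)

lemma op_norm_nonneg:
  assumes "A \<in> carrier_mat m d"
  shows "0 \<le> op_norm A"
proof -
  have "0 \<le> l2_norm (A *\<^sub>v 0\<^sub>v d)" by (rule l2_norm_nonneg)
  also have "\<dots> \<le> op_norm A"
    by (rule l2_norm_mult_le_op_norm[OF assms]) (auto simp: l2_norm_def)
  finally show ?thesis .
qed

lemma l2_norm_unit_vec: "i < d \<Longrightarrow> l2_norm (unit_vec d i) = 1"
  by (simp add: l2_norm_def)

lemma mult_unit_vec_entry:
  fixes A :: "real mat"
  assumes "A \<in> carrier_mat m d" "r < m" "c < d"
  shows "(A *\<^sub>v unit_vec d c) $ r = A $$ (r, c)"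
  using assms by (simp)

lemma entry_le_op_norm:
  assumes A: "A \<in> carrier_mat m d" and rc: "r < m" "c < d"
  shows "\<bar>A $$ (r, c)\<bar> \<le> op_norm A"
proof -
  let ?w = "A *\<^sub>v unit_vec d c"
  have "\<bar>A $$ (r, c)\<bar> = \<bar>?w $ r\<bar>" using mult_unit_vec_entry[OF assms] by simp
  also have "\<dots> \<le> L2_set (\<lambda>i. \<bar>?w $ i\<bar>) {0..<m}"
    using rc by (intro member_le_L2_set) auto
  also have "\<dots> = l2_norm ?w"
    using A by (subst l2_norm_eq_L2_set[of _ m]) (auto simp: L2_set_def)
  also have "\<dots> \<le> op_norm A"
    using rc by (intro l2_norm_mult_le_op_norm[OF A]) (auto simp: l2_norm_unit_vec)
  finally show ?thesis .
qed

section \<open>Entrywise convergence of matrices\<close>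

definition entrywise_tendsto :: "nat \<Rightarrow> (nat \<Rightarrow> real mat) \<Rightarrow> real mat \<Rightarrow> bool" where
  "entrywise_tendsto d X A \<longleftrightarrow> (\<forall>k. X k \<in> carrier_mat d d) \<and> A \<in> carrier_mat d d \<and>
     (\<forall>i<d. \<forall>j<d. (\<lambda>k. X k $$ (i, j)) \<longlonglongrightarrow> A $$ (i, j))"

lemma entrywise_tendsto_const:
  "A \<in> carrier_mat d d \<Longrightarrow> entrywise_tendsto d (\<lambda>k. A) A"
  by (simp add: entrywise_tendsto_def)

lemma entrywise_tendsto_mult:
  assumes "entrywise_tendsto d X A" "entrywise_tendsto d Y B"
  shows "entrywise_tendsto d (\<lambda>k. X k * Y k) (A * B)"
proof -
  have c: "X k \<in> carrier_mat d d" "Y k \<in> carrier_mat d d" "A \<in> carrier_mat d d"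
    "B \<in> carrier_mat d d" for k
    using assms by (auto simp: entrywise_tendsto_def)
  have "(\<lambda>k. (X k * Y k) $$ (i, j)) \<longlonglongrightarrow> (A * B) $$ (i, j)" if "i < d" "j < d" for i j
    unfolding mult_mat_entry[OF c(1,2) that] mult_mat_entry[OF c(3,4) that]
    using assms that by (intro tendsto_intros) (auto simp: entrywise_tendsto_def)
  then show ?thesis
    unfolding entrywise_tendsto_def using mult_carrier_mat c by blast
qed

lemma entrywise_tendsto_minus:
  assumes "entrywise_tendsto d X A" "entrywise_tendsto d Y B"
  shows "entrywise_tendsto d (\<lambda>k. X k - Y k) (A - B)"
proof -
  have c: "X k \<in> carrier_mat d d" "Y k \<in> carrier_mat d d" "A \<in> carrier_mat d d"
    "B \<in> carrier_mat d d" for k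
    using assms by (auto simp: entrywise_tendsto_def)
  then have "dim_row (Y k) = d" "dim_col (Y k) = d" "dim_row B = d" "dim_col B = d" for k
    by auto
  with assms c show ?thesis by (auto simp: entrywise_tendsto_def intro!: tendsto_diff)
qed

lemma entrywise_tendsto_transpose:
  assumes "entrywise_tendsto d X A"
  shows "entrywise_tendsto d (\<lambda>k. (X k)\<^sup>T) (A\<^sup>T)"
proof -
  have c: "X k \<in> carrier_mat d d" "A \<in> carrier_mat d d" for k
    using assms by (auto simp: entrywise_tendsto_def)
  then have "dim_row (X k) = d" "dim_col (X k) = d" "dim_row A = d" "dim_col A = d" for k
    by auto
  with assms show ?thesis by (auto simp: entrywise_tendsto_def)
qed

lemma entrywise_tendsto_diag_part:
  assumes "entrywise_tendsto d X A"
  shows "entrywise_tendsto d (\<lambda>k. diag_part (X k)) (diag_part A)"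
proof -
  have c: "X k \<in> carrier_mat d d" "A \<in> carrier_mat d d" for k
    using assms by (auto simp: entrywise_tendsto_def)
  then have "dim_row (X k) = d" "dim_col (X k) = d" "dim_row A = d" "dim_col A = d" for k
    by auto
  with assms show ?thesis by (auto simp: entrywise_tendsto_def diag_part_def)
qed

lemma entrywise_tendsto_mat_sum:
  assumes "\<And>i. i \<in> I \<Longrightarrow> entrywise_tendsto d (\<lambda>k. X k i) (A i)"
  shows "entrywise_tendsto d (\<lambda>k. mat_sum d (X k) I) (mat_sum d A I)"
  using assms by (auto simp: entrywise_tendsto_def mat_sum_def intro!: tendsto_sum)

lemma entrywise_tendsto_pinching:
  assumes "entrywise_tendsto d X U" "H \<in> carrier_mat d d"
  shows "entrywise_tendsto d (\<lambda>k. pinching (X k) H) (pinching U H)"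
  unfolding pinching_def
  by (intro entrywise_tendsto_mult entrywise_tendsto_diag_part entrywise_tendsto_transpose
      entrywise_tendsto_const assms)

definition pinching_defect :: "nat \<Rightarrow> ('i \<Rightarrow> real mat) \<Rightarrow> 'i set \<Rightarrow> real mat \<Rightarrow> real mat" where
  "pinching_defect d B I U = mat_sum d (\<lambda>i. mat_square (B i - pinching U (B i))) I"

lemma pinching_defect_carrier [simp]: "pinching_defect d B I U \<in> carrier_mat d d"
  by (simp add: pinching_defect_def mat_sum_def)

lemma entrywise_tendsto_pinching_defect:
  assumes "entrywise_tendsto d X U" "\<And>i. i \<in> I \<Longrightarrow> B i \<in> carrier_mat d d"
  shows "entrywise_tendsto d (\<lambda>k. pinching_defect d B I (X k)) (pinching_defect d B I U)"
  unfolding pinching_defect_def mat_square_def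
  by (intro entrywise_tendsto_mat_sum entrywise_tendsto_mult entrywise_tendsto_minus
      entrywise_tendsto_pinching entrywise_tendsto_const assms)

text \<open>Lower semicontinuity of the operator norm: \<open>l2_norm (X k *\<^sub>v v)\<close> converges for each fixed \<open>v\<close>, and
  a supremum of continuous functions is lower semicontinuous.\<close>
lemma op_norm_le_of_entrywise_tendsto:
  assumes X: "entrywise_tendsto d X A" and c: "c \<longlonglongrightarrow> m" and le: "\<And>k. op_norm (X k) \<le> c k"
  shows "op_norm A \<le> m"
proof -
  have cX: "X k \<in> carrier_mat d d" and cA: "A \<in> carrier_mat d d" for k
    using X by (auto simp: entrywise_tendsto_def)
  show ?thesis
  proof (rule op_norm_least[OF cA])
    fix v :: "real vec" assume v: "v \<in> carrier_vec d" "l2_norm v \<le> 1"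
    have entry: "(\<lambda>k. (X k *\<^sub>v v) $ r) \<longlonglongrightarrow> (A *\<^sub>v v) $ r" if "r < d" for r
      unfolding mult_mat_vec_entry[OF cX v(1) that] mult_mat_vec_entry[OF cA v(1) that]
      using X that by (intro tendsto_intros) (auto simp: entrywise_tendsto_def)
    have dims: "X k *\<^sub>v v \<in> carrier_vec d" "A *\<^sub>v v \<in> carrier_vec d" for k
      using mult_mat_vec_carrier[OF cX v(1)] mult_mat_vec_carrier[OF cA v(1)] by auto
    have "(\<lambda>k. l2_norm (X k *\<^sub>v v)) \<longlonglongrightarrow> l2_norm (A *\<^sub>v v)"
      unfolding l2_norm_eq_L2_set[OF dims(1)] l2_norm_eq_L2_set[OF dims(2)] L2_set_def
      by (intro tendsto_intros entry) auto
    moreover have "l2_norm (X k *\<^sub>v v) \<le> c k" for k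
      using l2_norm_mult_le_op_norm[OF cX v] le order_trans by blast
    ultimately show "l2_norm (A *\<^sub>v v) \<le> m" using c by (intro LIMSEQ_le) auto
  qed
qed

section \<open>Compactness of the orthogonal group and existence of the minimum\<close>

lemma bounded_family_convergent_subsequence:
  fixes X :: "nat \<Rightarrow> 'a \<Rightarrow> real"
  assumes "finite F" "\<And>k a. a \<in> F \<Longrightarrow> \<bar>X k a\<bar> \<le> C"
  shows "\<exists>r L. strict_mono (r :: nat \<Rightarrow> nat) \<and> (\<forall>a\<in>F. (\<lambda>k. X (r k) a) \<longlonglongrightarrow> L a)"
  using assms
proof (induction F)
  case empty
  have "strict_mono (\<lambda>k::nat. k)" by (simp add: strict_mono_def)
  then show ?case by auto
next
  case (insert a F)
  then obtain r :: "nat \<Rightarrow> nat" and L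
    where r: "strict_mono r" "\<And>b. b \<in> F \<Longrightarrow> (\<lambda>k. X (r k) b) \<longlonglongrightarrow> L b" by auto blast
  obtain q :: "nat \<Rightarrow> nat" where q: "strict_mono q" "monoseq (\<lambda>k. X (r (q k)) a)"
    using seq_monosub[of "\<lambda>k. X (r k) a"] by auto
  have "Bseq (\<lambda>k. X (r (q k)) a)" using insert.prems by (intro BseqI'[of _ C]) auto
  then obtain l where l: "(\<lambda>k. X (r (q k)) a) \<longlonglongrightarrow> l"
    using q(2) Bseq_monoseq_convergent convergent_def by blast
  have "(\<lambda>k. X ((r \<circ> q) k) b) \<longlonglongrightarrow> (L(a := l)) b" if "b \<in> insert a F" for b
  proof (cases "b = a")
    case False
    with that have "b \<in> F" by simp
    from LIMSEQ_subseq_LIMSEQ[OF r(2)[OF this] q(1)] False show ?thesis by (simp add: o_def)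
  qed (use l in auto)
  moreover have "strict_mono (r \<circ> q)" using r(1) q(1) by (rule strict_mono_o)
  ultimately show ?case by blast
qed

lemma orthogonal_group_columns:
  assumes "U \<in> orthogonal_group d" "k < d" "l < d"
  shows "(\<Sum>a = 0..<d. U $$ (a, k) * U $$ (a, l)) = (if k = l then 1 else 0)"
proof -
  have U: "U \<in> carrier_mat d d" and "U\<^sup>T * U = 1\<^sub>m d"
    using assms by (auto simp: orthogonal_group_def)
  have "(\<Sum>a = 0..<d. U $$ (a, k) * U $$ (a, l)) = (U\<^sup>T * U) $$ (k, l)"
    using U assms by (subst mult_mat_entry[of _ d d _ d]) auto
  with \<open>U\<^sup>T * U = 1\<^sub>m d\<close> show ?thesis using assms by simp
qed

lemma orthogonal_group_transpose: "U \<in> orthogonal_group d \<Longrightarrow> U\<^sup>T \<in> orthogonal_group d"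
  by (auto simp: orthogonal_group_def)

lemma orthogonal_group_rows:
  assumes "U \<in> orthogonal_group d" "k < d" "l < d"
  shows "(\<Sum>a = 0..<d. U $$ (k, a) * U $$ (l, a)) = (if k = l then 1 else 0)"
proof -
  have "dim_row U = d" "dim_col U = d" using assms by (auto simp: orthogonal_group_def)
  then show ?thesis
    using orthogonal_group_columns[OF orthogonal_group_transpose[OF assms(1)] assms(2,3)] assms
    by simp
qed

lemma orthogonal_group_entry_le_1:
  assumes U: "U \<in> orthogonal_group d" and "i < d" "j < d"
  shows "\<bar>U $$ (i, j)\<bar> \<le> 1"
proof -
  have "(U $$ (i, j))\<^sup>2 \<le> (\<Sum>a = 0..<d. (U $$ (a, j))\<^sup>2)"
    using assms by (intro member_le_sum) auto
  also have "\<dots> = 1" using orthogonal_group_columns[OF U, of j j] assms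
    by (simp add: power2_eq_square)
  finally show ?thesis by (simp add: abs_square_le_1)
qed

lemma entrywise_tendsto_unique:
  assumes "entrywise_tendsto d (\<lambda>k. C) A"
  shows "A = C"
proof (rule eq_matI)
  fix i j assume "i < dim_row C" "j < dim_col C"
  with assms have "(\<lambda>k::nat. C $$ (i, j)) \<longlonglongrightarrow> A $$ (i, j)" by (auto simp: entrywise_tendsto_def)
  then show "A $$ (i, j) = C $$ (i, j)" by (simp add: LIMSEQ_const_iff)
qed (use assms in \<open>auto simp: entrywise_tendsto_def\<close>)

lemma orthogonal_group_subsequence:
  assumes U: "\<And>k::nat. U k \<in> orthogonal_group d"
  shows "\<exists>r V. strict_mono (r :: nat \<Rightarrow> nat) \<and> V \<in> orthogonal_group d
           \<and> entrywise_tendsto d (\<lambda>k. U (r k)) V"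
proof -
  obtain r :: "nat \<Rightarrow> nat" and L where r: "strict_mono r"
    and L: "\<forall>p\<in>{..<d} \<times> {..<d}. (\<lambda>k. U (r k) $$ p) \<longlonglongrightarrow> L p"
    using bounded_family_convergent_subsequence[of "{..<d} \<times> {..<d}" "\<lambda>k p. U k $$ p" 1]
      orthogonal_group_entry_le_1[OF U] by auto
  define V where "V = mat d d L"
  have lim: "entrywise_tendsto d (\<lambda>k. U (r k)) V"
    using L U by (auto simp: entrywise_tendsto_def V_def orthogonal_group_def)
  have "V\<^sup>T * V = 1\<^sub>m d" "V * V\<^sup>T = 1\<^sub>m d"
    using entrywise_tendsto_mult[OF entrywise_tendsto_transpose[OF lim] lim]
      entrywise_tendsto_mult[OF lim entrywise_tendsto_transpose[OF lim]] U
    by (auto simp: orthogonal_group_def intro!: entrywise_tendsto_unique)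
  then have "V \<in> orthogonal_group d" by (simp add: orthogonal_group_def V_def)
  with r lim show ?thesis by blast
qed

lemma one_mat_orthogonal: "1\<^sub>m d \<in> orthogonal_group d"
  by (simp add: orthogonal_group_def)

text \<open>A minimizing sequence of orthogonal matrices has a subsequence with an orthogonal limit, and by
  lower semicontinuity the objective at the limit does not exceed the infimum.\<close>
lemma nu_attained:
  assumes B: "\<And>i. i \<in> I \<Longrightarrow> B i \<in> carrier_mat d d"
  obtains V where "V \<in> orthogonal_group d" "nu d B I = op_norm (pinching_defect d B I V)"
    "\<And>U. U \<in> orthogonal_group d \<Longrightarrow> nu d B I \<le> op_norm (pinching_defect d B I U)"
proof -
  define f where "f U = op_norm (pinching_defect d B I U)" for U
  define m where "m = Inf (f ` orthogonal_group d)"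
  have bdd: "bdd_below (f ` orthogonal_group d)"
    unfolding f_def by (rule bdd_belowI2[of _ 0]) (rule op_norm_nonneg[OF pinching_defect_carrier])
  have m_le: "m \<le> f U" if "U \<in> orthogonal_group d" for U
    unfolding m_def using that by (intro cINF_lower bdd)
  have "\<exists>U \<in> orthogonal_group d. f U < m + inverse (real (Suc k))" for k
    using cInf_lessD[of "f ` orthogonal_group d" "m + inverse (real (Suc k))"] one_mat_orthogonal
    by (fastforce simp: m_def)
  then obtain U where U: "\<And>k. U k \<in> orthogonal_group d"
    and Um: "\<And>k. f (U k) < m + inverse (real (Suc k))" by metis
  obtain r V where r: "strict_mono (r :: nat \<Rightarrow> nat)" and V: "V \<in> orthogonal_group d"
    and lim: "entrywise_tendsto d (\<lambda>k. U (r k)) V"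
    using orthogonal_group_subsequence[of U d, OF U] by (elim exE conjE)
  have "(\<lambda>k. m + inverse (real (Suc k))) \<longlonglongrightarrow> m"
    by (rule LIMSEQ_inverse_real_of_nat_add)
  then have m_lim: "(\<lambda>k. m + inverse (real (Suc (r k)))) \<longlonglongrightarrow> m"
    by (rule LIMSEQ_subseq_LIMSEQ[OF _ r, unfolded o_def])
  have le: "op_norm (pinching_defect d B I (U (r k))) \<le> m + inverse (real (Suc (r k)))" for k
    using less_imp_le[OF Um[of "r k"]] by (simp only: f_def)
  have "entrywise_tendsto d (\<lambda>k. pinching_defect d B I (U (r k))) (pinching_defect d B I V)"
    using lim B by (rule entrywise_tendsto_pinching_defect)
  then have "f V \<le> m"
    unfolding f_def by (rule op_norm_le_of_entrywise_tendsto[OF _ m_lim le])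
  with m_le V have least: "f V \<le> f U" if "U \<in> orthogonal_group d" for U
    using that by force
  have "nu d B I = f V"
    unfolding nu_def f_def[symmetric] pinching_defect_def[symmetric]
    using V least by (intro Least_equality) auto
  with V least show ?thesis using that unfolding f_def by metis
qed

section \<open>Star matrices and their pinchings\<close>

lemma star_mat_carrier [simp]: "star_mat n i \<in> carrier_mat (n + 1) (n + 1)"
  by (simp add: star_mat_def outer_prod_def)

lemma star_mat_dims [simp]:
  "dim_row (star_mat n i) = n + 1" "dim_col (star_mat n i) = n + 1"
  using star_mat_carrier[of n i] by (simp_all only: carrier_matD)

lemma star_mat_entry:
  assumes "1 \<le> i" "i \<le> n" "r \<le> n" "c \<le> n"
  shows "star_mat n i $$ (r, c) =
    (if r = 0 \<and> c = i \<or> r = i \<and> c = 0 then 1 / sqrt 2 else 0)"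
  using assms by (auto simp: star_mat_def outer_prod_def)

lemma star_mat_sym:
  assumes "1 \<le> i" "i \<le> n"
  shows "star_mat n i \<in> sym_mats (n + 1)"
  using assms by (auto simp: sym_mats_def star_mat_entry)


lemma pinching_carrier:
  "U \<in> carrier_mat d d \<Longrightarrow> H \<in> carrier_mat d d \<Longrightarrow> pinching U H \<in> carrier_mat d d"
  by (auto simp: pinching_def diag_part_def)

lemma pinching_entry:
  assumes U: "U \<in> carrier_mat d d" and H: "H \<in> carrier_mat d d" and rc: "r < d" "c < d"
  shows "pinching U H $$ (r, c) =
    (\<Sum>k = 0..<d. U $$ (r, k) * (U\<^sup>T * H * U) $$ (k, k) * U $$ (c, k))"
proof -
  let ?D = "diag_part (U\<^sup>T * H * U)"
  have D: "?D \<in> carrier_mat d d"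
    using U H by (auto simp: diag_part_def)
  have D_entry: "?D $$ (j, k) = (if j = k then (U\<^sup>T * H * U) $$ (k, k) else 0)"
    if "j < d" "k < d" for j k
    using U H that by (auto simp: diag_part_def simp del: index_mult_mat(1))
  have UD: "(U * ?D) $$ (r, k) = U $$ (r, k) * (U\<^sup>T * H * U) $$ (k, k)" if "k < d" for k
  proof -
    have "(U * ?D) $$ (r, k) =
        (\<Sum>j = 0..<d. if j = k then U $$ (r, k) * (U\<^sup>T * H * U) $$ (k, k) else 0)"
      unfolding mult_mat_entry[OF U D rc(1) that]
      using that by (intro sum.cong) (auto simp: D_entry simp del: index_mult_mat(1))
    then show ?thesis using that by simp
  qed
  have "pinching U H $$ (r, c) = (\<Sum>k = 0..<d. (U * ?D) $$ (r, k) * U\<^sup>T $$ (k, c))"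
    unfolding pinching_def
    using U D rc by (intro mult_mat_entry[of _ d d _ d]) auto
  also have "\<dots> = (\<Sum>k = 0..<d. U $$ (r, k) * (U\<^sup>T * H * U) $$ (k, k) * U $$ (c, k))"
    using U rc by (intro sum.cong refl) (simp add: UD del: index_mult_mat(1))
  finally show ?thesis .
qed

lemma star_mat_quadratic_form:
  assumes U: "U \<in> carrier_mat (n + 1) (n + 1)" and i: "1 \<le> i" "i \<le> n" and k: "k \<le> n"
  shows "(U\<^sup>T * star_mat n i * U) $$ (k, k) = sqrt 2 * U $$ (0, k) * U $$ (i, k)"
proof -
  let ?B = "star_mat n i"
  have UB: "(U\<^sup>T * ?B) $$ (k, c) =
      (if c = 0 then U $$ (i, k) / sqrt 2 else if c = i then U $$ (0, k) / sqrt 2 else 0)"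
    if "c \<le> n" for c
  proof -
    have "(U\<^sup>T * ?B) $$ (k, c) = (\<Sum>r = 0..<n + 1. U\<^sup>T $$ (k, r) * ?B $$ (r, c))"
      using k that U by (intro mult_mat_entry[of _ "n + 1", OF _ star_mat_carrier]) auto
    also have "\<dots> = (\<Sum>r = 0..<n + 1. if r = (if c = 0 then i else 0)
        then (if c = 0 \<or> c = i then U $$ (r, k) / sqrt 2 else 0) else 0)"
      using U i k that by (intro sum.cong refl) (auto simp: star_mat_entry)
    also have "\<dots> = (if c = 0 then U $$ (i, k) / sqrt 2
        else if c = i then U $$ (0, k) / sqrt 2 else 0)"
      using i by (subst sum.delta) auto
    finally show ?thesis .
  qed
  have "(U\<^sup>T * ?B * U) $$ (k, k) = (\<Sum>c = 0..<n + 1. (U\<^sup>T * ?B) $$ (k, c) * U $$ (c, k))"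
    using U k by (intro mult_mat_entry[of _ "n + 1" _ _ "n + 1"]) auto
  also have "\<dots> = (\<Sum>c = 0..<n + 1. (if c = 0 then U $$ (i, k) / sqrt 2 * U $$ (0, k) else 0)
      + (if c = i then U $$ (0, k) / sqrt 2 * U $$ (i, k) else 0))"
    using i by (intro sum.cong refl) (auto simp: UB simp del: index_mult_mat(1))
  also have "\<dots> = U $$ (i, k) / sqrt 2 * U $$ (0, k) + U $$ (0, k) / sqrt 2 * U $$ (i, k)"
    unfolding sum.distrib using i by (simp add: sum.delta)
  also have "\<dots> = sqrt 2 * U $$ (0, k) * U $$ (i, k)"
    by (simp add: field_simps)
  finally show ?thesis .
qed

text \<open>Parseval's identity for the orthonormal columns of \<open>U\<close>.\<close>
lemma orthogonal_combination_norm: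
  assumes U: "U \<in> orthogonal_group d"
  shows "(\<Sum>r = 0..<d. (\<Sum>k = 0..<d. U $$ (r, k) * x k)\<^sup>2) = (\<Sum>k = 0..<d. (x k)\<^sup>2)"
proof -
  let ?t = "\<lambda>r k l. x k * x l * (U $$ (r, k) * U $$ (r, l))"
  have "(\<Sum>r = 0..<d. (\<Sum>k = 0..<d. U $$ (r, k) * x k)\<^sup>2) =
      (\<Sum>r = 0..<d. \<Sum>k = 0..<d. \<Sum>l = 0..<d. ?t r k l)"
    by (simp add: power2_eq_square sum_product mult_ac)
  also have "\<dots> = (\<Sum>k = 0..<d. \<Sum>r = 0..<d. \<Sum>l = 0..<d. ?t r k l)"
    by (rule sum.swap)
  also have "\<dots> = (\<Sum>k = 0..<d. \<Sum>l = 0..<d. \<Sum>r = 0..<d. ?t r k l)"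
    by (intro sum.cong refl sum.swap)
  also have "\<dots> = (\<Sum>k = 0..<d. \<Sum>l = 0..<d. if k = l then x k * x l else 0)"
    unfolding sum_distrib_left[symmetric]
    using orthogonal_group_columns[OF U] by (intro sum.cong refl) auto
  also have "\<dots> = (\<Sum>k = 0..<d. (x k)\<^sup>2)"
    by (simp add: power2_eq_square)
  finally show ?thesis .
qed

text \<open>The pinching of \<open>B\<^sub>i\<close> maps \<open>e\<^sub>0\<close> to the combination of the columns of \<open>U\<close> with coefficients
  \<open>sqrt 2 a\<^sub>k U\<^sub>i\<^sub>k\<close>, where \<open>a\<^sub>k = U\<^sub>0\<^sub>k\<^sup>2\<close>. By Parseval, and since columns have length 1, the double sum is
  \<open>\<Sum>\<^sub>k 2 a\<^sub>k\<^sup>2 (1 - a\<^sub>k)\<close>. The rows of \<open>U\<close> have length 1 as well, so the \<open>a\<^sub>k\<close> sum to 1, and each term is at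
  most \<open>a\<^sub>k / 2\<close>.\<close>
lemma pinched_first_column_bound:
  assumes U: "U \<in> orthogonal_group (n + 1)"
  shows "(\<Sum>i = 1..n. \<Sum>r = 0..<n + 1. (pinching U (star_mat n i) $$ (r, 0))\<^sup>2) \<le> 1 / 2"
proof -
  have Uc: "U \<in> carrier_mat (n + 1) (n + 1)" using U by (simp add: orthogonal_group_def)
  define a where "a k = (U $$ (0, k))\<^sup>2" for k
  have col: "(\<Sum>i = 1..n. (U $$ (i, k))\<^sup>2) = 1 - a k" if "k < n + 1" for k
  proof -
    have "(\<Sum>r = 0..n. (U $$ (r, k))\<^sup>2) = 1"
      using orthogonal_group_columns[OF U that that]
      by (simp add: power2_eq_square atLeastLessThanSuc_atLeastAtMost)
    then show ?thesis
      by (simp add: a_def sum.atLeast_Suc_atMost)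
  qed
  have row: "(\<Sum>k = 0..<n + 1. a k) = 1"
    using orthogonal_group_rows[OF U, of 0 0] by (simp add: a_def power2_eq_square)
  have "(\<Sum>i = 1..n. \<Sum>r = 0..<n + 1. (pinching U (star_mat n i) $$ (r, 0))\<^sup>2)
      = (\<Sum>i = 1..n. \<Sum>k = 0..<n + 1. 2 * (a k)\<^sup>2 * (U $$ (i, k))\<^sup>2)"
  proof (rule sum.cong[OF refl])
    fix i assume i: "i \<in> {1..n}"
    have "pinching U (star_mat n i) $$ (r, 0) =
        (\<Sum>k = 0..<n + 1. U $$ (r, k) * (sqrt 2 * a k * U $$ (i, k)))" if "r < n + 1" for r
      using that i star_mat_quadratic_form[OF Uc, of i]
      by (subst pinching_entry[OF Uc star_mat_carrier])
        (auto simp: a_def power2_eq_square simp del: index_mult_mat(1) sum.op_ivl_Suc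
          intro!: sum.cong)
    then have "(\<Sum>r = 0..<n + 1. (pinching U (star_mat n i) $$ (r, 0))\<^sup>2) =
        (\<Sum>r = 0..<n + 1. (\<Sum>k = 0..<n + 1. U $$ (r, k) * (sqrt 2 * a k * U $$ (i, k)))\<^sup>2)"
      by (intro sum.cong refl) auto
    also have "\<dots> = (\<Sum>k = 0..<n + 1. (sqrt 2 * a k * U $$ (i, k))\<^sup>2)"
      by (rule orthogonal_combination_norm[OF U])
    finally show "(\<Sum>r = 0..<n + 1. (pinching U (star_mat n i) $$ (r, 0))\<^sup>2) =
        (\<Sum>k = 0..<n + 1. 2 * (a k)\<^sup>2 * (U $$ (i, k))\<^sup>2)"
      by (simp add: power_mult_distrib)
  qed
  also have "\<dots> = (\<Sum>k = 0..<n + 1. 2 * (a k)\<^sup>2 * (\<Sum>i = 1..n. (U $$ (i, k))\<^sup>2))"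
    unfolding sum_distrib_left by (rule sum.swap)
  also have "\<dots> \<le> (\<Sum>k = 0..<n + 1. a k / 2)"
  proof (rule sum_mono)
    fix k assume "k \<in> {0..<n + 1}"
    \<comment> \<open>\<open>2 a (1 - a) \<le> 1 / 2\<close> multiplied by \<open>a\<close>, as a square: the maximum is at \<open>a = 1 / 2\<close>.\<close>
    have "0 \<le> 2 * a k * (a k - 1 / 2)\<^sup>2" by (simp add: a_def)
    also have "\<dots> = a k / 2 - 2 * (a k)\<^sup>2 * (1 - a k)"
      by (simp add: power2_eq_square algebra_simps)
    finally show "2 * (a k)\<^sup>2 * (\<Sum>i = 1..n. (U $$ (i, k))\<^sup>2) \<le> a k / 2"
      using col \<open>k \<in> {0..<n + 1}\<close> by simp
  qed
  also have "\<dots> = 1 / 2" using row by (simp only: sum_divide_distrib[symmetric])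
  finally show ?thesis .
qed

section \<open>Bounds on the pinching defect\<close>

text \<open>Minkowski's inequality is applied to the first columns of all \<open>B\<^sub>i\<close> and of all their pinchings,
  each family read as one long vector indexed by the pairs \<open>(i, r)\<close>.\<close>
lemma pinching_defect_lower_bound:
  assumes n: "1 \<le> n" and U: "U \<in> orthogonal_group (n + 1)"
  shows "(sqrt (real n) - 1)\<^sup>2 / 2 \<le> op_norm (pinching_defect (n + 1) (star_mat n) {1..n} U)"
proof -
  have Uc: "U \<in> carrier_mat (n + 1) (n + 1)" using U by (simp add: orthogonal_group_def)
  define P where "P i = pinching U (star_mat n i)" for i
  have P: "P i \<in> carrier_mat (n + 1) (n + 1)" for i
    unfolding P_def by (rule pinching_carrier[OF Uc star_mat_carrier])
  have P_sym: "P i $$ (r, 0) = P i $$ (0, r)" if "r < n + 1" for i r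
    unfolding P_def using that
    by (simp add: pinching_entry[OF Uc star_mat_carrier] mult_ac del: index_mult_mat(1))
  define C where "C i = star_mat n i - P i" for i
  have C: "C i \<in> carrier_mat (n + 1) (n + 1)" for i
    unfolding C_def using P by (rule minus_carrier_mat)
  have C_entry: "C i $$ (r, c) = star_mat n i $$ (r, c) - P i $$ (r, c)"
    if "r < n + 1" "c < n + 1" for i r c
    unfolding C_def using that P[of i] by (intro index_minus_mat) auto
  let ?J = "{1..n} \<times> {0..<n + 1}"
  define b where "b = (\<lambda>(i, r). star_mat n i $$ (r, 0))"
  define p where "p = (\<lambda>(i, r). P i $$ (r, 0))"
  have star_col: "(\<Sum>r = 0..<n + 1. (star_mat n i $$ (r, 0))\<^sup>2) = 1 / 2" if "i \<in> {1..n}" for i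
  proof -
    have "(\<Sum>r = 0..<n + 1. (star_mat n i $$ (r, 0))\<^sup>2) =
        (\<Sum>r = 0..<n + 1. if r = i then 1 / 2 else 0)"
      using that by (intro sum.cong refl) (auto simp: star_mat_entry power_divide)
    then show ?thesis using that by simp
  qed
  have "(\<Sum>i = 1..n. \<Sum>r = 0..<n + 1. (star_mat n i $$ (r, 0))\<^sup>2) = (\<Sum>i = 1..n. 1 / 2)"
    by (intro sum.cong refl star_col)
  then have "L2_set b ?J = sqrt (real n / 2)"
    unfolding L2_set_def b_def sum.cartesian_product' by (simp del: sum.op_ivl_Suc)
  moreover have "L2_set p ?J \<le> sqrt (1 / 2)"
    using pinched_first_column_bound[OF U]
    unfolding L2_set_def p_def P_def sum.cartesian_product' by (simp del: sum.op_ivl_Suc)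
  moreover have "L2_set b ?J \<le> L2_set (\<lambda>x. b x - p x) ?J + L2_set p ?J"
    using L2_set_triangle_ineq[of "\<lambda>x. b x - p x" p ?J] by simp
  ultimately have "(sqrt (real n) - 1) / sqrt 2 \<le> L2_set (\<lambda>x. b x - p x) ?J"
    by (simp add: real_sqrt_divide diff_divide_distrib)
  \<comment> \<open>Squaring keeps the inequality only because \<open>n \<ge> 1\<close> makes the left side nonnegative.\<close>
  then have "((sqrt (real n) - 1) / sqrt 2)\<^sup>2 \<le> (L2_set (\<lambda>x. b x - p x) ?J)\<^sup>2"
    using n by (intro power_mono) auto
  also have "\<dots> = (\<Sum>i = 1..n. \<Sum>r = 0..<n + 1. (C i $$ (r, 0))\<^sup>2)"
    unfolding L2_set_def b_def p_def sum.cartesian_product'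
    by (simp add: sum_nonneg C_entry del: sum.op_ivl_Suc)
  also have "\<dots> = (\<Sum>i = 1..n. mat_square (C i) $$ (0, 0))"
  proof (rule sum.cong[OF refl])
    fix i assume i: "i \<in> {1..n}"
    have "C i $$ (0, r) = C i $$ (r, 0)" if "r < n + 1" for r
      using that i by (auto simp: C_entry P_sym star_mat_entry)
    then show "(\<Sum>r = 0..<n + 1. (C i $$ (r, 0))\<^sup>2) = mat_square (C i) $$ (0, 0)"
      unfolding mat_square_def
      by (subst mult_mat_entry[OF C C]) (auto simp: power2_eq_square intro!: sum.cong)
  qed
  also have "\<dots> = pinching_defect (n + 1) (star_mat n) {1..n} U $$ (0, 0)"
    by (simp add: pinching_defect_def mat_sum_def C_def P_def)
  also have "\<dots> \<le> op_norm (pinching_defect (n + 1) (star_mat n) {1..n} U)"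
    using entry_le_op_norm[OF pinching_defect_carrier, of 0 "n + 1" 0 "star_mat n" "{1..n}" U]
    by simp
  finally show ?thesis by (simp add: power_divide)
qed

lemma pinching_one_star_mat:
  assumes "1 \<le> i" "i \<le> n"
  shows "pinching (1\<^sub>m (n + 1)) (star_mat n i) = 0\<^sub>m (n + 1) (n + 1)"
proof -
  have "diag_part (star_mat n i) = 0\<^sub>m (n + 1) (n + 1)"
  proof (rule eq_matI)
    fix r c assume "r < dim_row (0\<^sub>m (n + 1) (n + 1))" "c < dim_col (0\<^sub>m (n + 1) (n + 1))"
    then show "diag_part (star_mat n i) $$ (r, c) = 0\<^sub>m (n + 1) (n + 1) $$ (r, c)"
      using assms by (auto simp: diag_part_def star_mat_entry)
  qed (auto simp: diag_part_def)
  then show ?thesis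
    using star_mat_carrier[of n i]
    by (simp add: pinching_def)
qed

lemma pinching_defect_one_entry:
  assumes rc: "r < n + 1" "c < n + 1"
  shows "pinching_defect (n + 1) (star_mat n) {1..n} (1\<^sub>m (n + 1)) $$ (r, c) =
    (if r = c then if r = 0 then real n / 2 else 1 / 2 else 0)"
proof -
  have sq: "mat_square (star_mat n i - pinching (1\<^sub>m (n + 1)) (star_mat n i)) $$ (r, c) =
      (if r = c then if r = 0 \<or> r = i then 1 / 2 else 0 else 0)" if i: "i \<in> {1..n}" for i
  proof -
    have "star_mat n i - pinching (1\<^sub>m (n + 1)) (star_mat n i) = star_mat n i"
      using i by (subst pinching_one_star_mat) (auto intro!: eq_matI)
    then have "mat_square (star_mat n i - pinching (1\<^sub>m (n + 1)) (star_mat n i)) $$ (r, c) =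
        (\<Sum>k = 0..<n + 1. star_mat n i $$ (r, k) * star_mat n i $$ (k, c))"
      using mult_mat_entry[OF star_mat_carrier star_mat_carrier rc] by (simp only: mat_square_def)
    also have "\<dots> = (\<Sum>k = 0..<n + 1. if k = (if r = 0 then i else 0)
        then (if r = c \<and> (r = 0 \<or> r = i) then 1 / 2 else 0) else 0)"
      using i rc by (intro sum.cong refl) (auto simp: star_mat_entry)
    finally show ?thesis using i rc by (simp del: sum.op_ivl_Suc)
  qed
  have "pinching_defect (n + 1) (star_mat n) {1..n} (1\<^sub>m (n + 1)) $$ (r, c) =
      (\<Sum>i = 1..n. if r = c then if r = 0 \<or> r = i then 1 / 2 else 0 else 0)"
    unfolding pinching_defect_def mat_sum_def using rc sq by simp
  also have "\<dots> = (if r = c then if r = 0 then real n / 2 else 1 / 2 else 0)"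
    using rc by auto
  finally show ?thesis .
qed

lemma op_norm_pinching_defect_one:
  assumes n: "1 \<le> n"
  shows "op_norm (pinching_defect (n + 1) (star_mat n) {1..n} (1\<^sub>m (n + 1))) \<le> real n / 2"
proof (rule op_norm_least[OF pinching_defect_carrier])
  let ?M = "pinching_defect (n + 1) (star_mat n) {1..n} (1\<^sub>m (n + 1))"
  fix v :: "real vec" assume v: "v \<in> carrier_vec (n + 1)" "l2_norm v \<le> 1"
  have Mv: "?M *\<^sub>v v \<in> carrier_vec (n + 1)"
    using mult_mat_vec_carrier[OF pinching_defect_carrier v(1)] .
  have entry: "\<bar>(?M *\<^sub>v v) $ r\<bar> \<le> real n / 2 * \<bar>v $ r\<bar>" if "r < n + 1" for r
  proof -
    have "(?M *\<^sub>v v) $ r =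
        (\<Sum>j = 0..<n + 1. if j = r then (if r = 0 then real n / 2 else 1 / 2) * v $ j else 0)"
      unfolding mult_mat_vec_entry[OF pinching_defect_carrier v(1) that]
    proof (rule sum.cong[OF refl])
      fix j assume "j \<in> {0..<n + 1}"
      then show "?M $$ (r, j) * v $ j =
          (if j = r then (if r = 0 then real n / 2 else 1 / 2) * v $ j else 0)"
        by (subst pinching_defect_one_entry[OF that]) auto
    qed
    also have "\<dots> = (if r = 0 then real n / 2 else 1 / 2) * v $ r"
      using that by (simp del: sum.op_ivl_Suc)
    finally have "\<bar>(?M *\<^sub>v v) $ r\<bar> = (if r = 0 then real n / 2 else 1 / 2) * \<bar>v $ r\<bar>"
      by (simp add: abs_mult)
    also have "\<dots> \<le> real n / 2 * \<bar>v $ r\<bar>"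
      using n by (intro mult_right_mono) auto
    finally show ?thesis .
  qed
  have "l2_norm (?M *\<^sub>v v) = L2_set (\<lambda>r. \<bar>(?M *\<^sub>v v) $ r\<bar>) {0..<n + 1}"
    using l2_norm_eq_L2_set[OF Mv] by (simp add: L2_set_def)
  also have "\<dots> \<le> L2_set (\<lambda>r. real n / 2 * \<bar>v $ r\<bar>) {0..<n + 1}"
    using entry by (intro L2_set_mono) auto
  also have "\<dots> = real n / 2 * L2_set (\<lambda>r. \<bar>v $ r\<bar>) {0..<n + 1}"
    by (rule L2_set_right_distrib[symmetric]) simp
  also have "\<dots> = real n / 2 * l2_norm v"
    using l2_norm_eq_L2_set[OF v(1)] by (simp add: L2_set_def)
  also have "\<dots> \<le> real n / 2" using v(2) by (intro mult_left_le) auto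
  finally show "l2_norm (?M *\<^sub>v v) \<le> real n / 2" .
qed

section \<open>Signed sums\<close>

text \<open>The first row and the first column of the signed sum act on complementary parts of \<open>v\<close>, and their
  contributions to the squared length do not interfere.\<close>
lemma signed_sum_star_mat_mult:
  assumes v: "v \<in> carrier_vec (n + 1)"
  shows "l2_norm (signed_sum (n + 1) n s (star_mat n) *\<^sub>v v) =
    sqrt (((\<Sum>i = 1..n. s i * v $ i)\<^sup>2 + (v $ 0)\<^sup>2 * (\<Sum>i = 1..n. (s i)\<^sup>2)) / 2)"
proof -
  define A where "A = signed_sum (n + 1) n s (star_mat n)"
  have A: "A \<in> carrier_mat (n + 1) (n + 1)" by (simp add: A_def signed_sum_def mat_sum_def)
  have A_entry: "A $$ (r, c) = (if r = 0 \<and> c \<noteq> 0 then s c / sqrt 2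
      else if r \<noteq> 0 \<and> c = 0 then s r / sqrt 2 else 0)" if "r < n + 1" "c < n + 1" for r c
  proof -
    have "A $$ (r, c) = (\<Sum>i = 1..n. s i * star_mat n i $$ (r, c))"
      using that by (auto simp: A_def signed_sum_def mat_sum_def intro!: sum.cong)
    also have "\<dots> = (\<Sum>i = 1..n. if i = (if r = 0 then c else r)
        then (if (r = 0) \<noteq> (c = 0) then s i / sqrt 2 else 0) else 0)"
      using that by (intro sum.cong refl) (auto simp: star_mat_entry)
    finally show ?thesis using that by auto
  qed
  have first: "(A *\<^sub>v v) $ 0 = (\<Sum>i = 1..n. s i * v $ i) / sqrt 2"
  proof -
    have "(A *\<^sub>v v) $ 0 = (\<Sum>c = 0..n. A $$ (0, c) * v $ c)"
      by (subst mult_mat_vec_entry[OF A v]) (auto simp: atLeastLessThanSuc_atLeastAtMost)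
    also have "\<dots> = (\<Sum>c = 1..n. A $$ (0, c) * v $ c)"
      by (simp add: sum.atLeast_Suc_atMost A_entry)
    also have "\<dots> = (\<Sum>i = 1..n. s i * v $ i / sqrt 2)"
      by (intro sum.cong refl) (auto simp: A_entry)
    finally show ?thesis by (simp add: sum_divide_distrib)
  qed
  have rest: "(A *\<^sub>v v) $ i = s i * v $ 0 / sqrt 2" if "i \<in> {1..n}" for i
  proof -
    have "(A *\<^sub>v v) $ i = (\<Sum>c = 0..n. A $$ (i, c) * v $ c)"
      using that by (subst mult_mat_vec_entry[OF A v]) (auto simp: atLeastLessThanSuc_atLeastAtMost)
    also have "\<dots> = (\<Sum>c = 0..n. if c = 0 then s i * v $ 0 / sqrt 2 else 0)"
      using that by (intro sum.cong refl) (auto simp: A_entry)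
    finally show ?thesis by simp
  qed
  have "(l2_norm (A *\<^sub>v v))\<^sup>2 = (\<Sum>r = 0..n. ((A *\<^sub>v v) $ r)\<^sup>2)"
    using l2_norm_eq_L2_set[OF mult_mat_vec_carrier[OF A v]]
    by (simp add: L2_set_def sum_nonneg atLeastLessThanSuc_atLeastAtMost del: sum.op_ivl_Suc)
  also have "\<dots> = ((A *\<^sub>v v) $ 0)\<^sup>2 + (\<Sum>i = 1..n. ((A *\<^sub>v v) $ i)\<^sup>2)"
    by (simp only: sum.atLeast_Suc_atMost[OF le0] One_nat_def)
  also have "\<dots> = ((\<Sum>i = 1..n. s i * v $ i)\<^sup>2 + (v $ 0)\<^sup>2 * (\<Sum>i = 1..n. (s i)\<^sup>2)) / 2"
  proof -
    have "(\<Sum>i = 1..n. ((A *\<^sub>v v) $ i)\<^sup>2) = (v $ 0)\<^sup>2 * (\<Sum>i = 1..n. (s i)\<^sup>2) / 2"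
      unfolding sum_distrib_left sum_divide_distrib
      by (intro sum.cong refl) (simp add: rest power_divide power_mult_distrib)
    then show ?thesis by (simp add: first power_divide add_divide_distrib del: index_mult_mat_vec)
  qed
  finally show ?thesis unfolding A_def by (metis l2_norm_nonneg real_sqrt_abs abs_of_nonneg)
qed

text \<open>The upper bound is the Cauchy-Schwarz inequality for \<open>s\<close> and the part of \<open>v\<close> orthogonal to \<open>e\<^sub>0\<close>; the
  vector \<open>e\<^sub>0\<close> attains it.\<close>
lemma op_norm_signed_sum_star_mat:
  assumes s: "s \<in> signings n"
  shows "op_norm (signed_sum (n + 1) n s (star_mat n)) = sqrt (real n / 2)"
proof (rule antisym)
  let ?A = "signed_sum (n + 1) n s (star_mat n)"
  have A: "?A \<in> carrier_mat (n + 1) (n + 1)" by (simp add: signed_sum_def mat_sum_def)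
  have "(s i)\<^sup>2 = 1" if "i \<in> {1..n}" for i
    using PiE_mem[OF s[unfolded signings_def] that] by auto
  then have s2: "(\<Sum>i = 1..n. (s i)\<^sup>2) = real n" by simp
  show "op_norm ?A \<le> sqrt (real n / 2)"
  proof (rule op_norm_least[OF A])
    fix v :: "real vec" assume v: "v \<in> carrier_vec (n + 1)" "l2_norm v \<le> 1"
    have "(\<Sum>i = 1..n. s i * v $ i)\<^sup>2 \<le> (\<Sum>i = 1..n. (s i)\<^sup>2) * (\<Sum>i = 1..n. (v $ i)\<^sup>2)"
      by (rule Cauchy_Schwarz_ineq_sum)
    then have "(\<Sum>i = 1..n. s i * v $ i)\<^sup>2 + (v $ 0)\<^sup>2 * (\<Sum>i = 1..n. (s i)\<^sup>2)
        \<le> real n * ((v $ 0)\<^sup>2 + (\<Sum>i = 1..n. (v $ i)\<^sup>2))"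
      unfolding s2 by (simp add: algebra_simps)
    also have "(v $ 0)\<^sup>2 + (\<Sum>i = 1..n. (v $ i)\<^sup>2) = (\<Sum>i = 0..<n + 1. (v $ i)\<^sup>2)"
      by (simp add: sum.atLeast_Suc_atMost[OF le0] atLeastLessThanSuc_atLeastAtMost
          del: sum.op_ivl_Suc)
    also have "\<dots> \<le> 1"
      using v(2) unfolding l2_norm_eq_L2_set[OF v(1)] L2_set_def by simp
    finally show "l2_norm (?A *\<^sub>v v) \<le> sqrt (real n / 2)"
      unfolding signed_sum_star_mat_mult[OF v(1)] s2 by (simp add: mult_left_mono)
  qed
  have "l2_norm (?A *\<^sub>v unit_vec (n + 1) 0) = sqrt (real n / 2)"
    by (subst signed_sum_star_mat_mult) (auto simp: s2 simp del: One_nat_def)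
  then show "sqrt (real n / 2) \<le> op_norm ?A"
    using l2_norm_mult_le_op_norm[OF A, of "unit_vec (n + 1) 0"] by (simp add: l2_norm_unit_vec)
qed

lemma frob_norm_star_mat:
  assumes i: "1 \<le> i" "i \<le> n"
  shows "frob_norm (star_mat n i) = 1"
proof -
  have "(\<Sum>c<n + 1. (star_mat n i $$ (r, c))\<^sup>2) =
      (if r = 0 then 1 / 2 else 0) + (if r = i then 1 / 2 else 0)" if "r < n + 1" for r
  proof -
    have "(\<Sum>c<n + 1. (star_mat n i $$ (r, c))\<^sup>2) =
        (\<Sum>c<n + 1. if c = (if r = 0 then i else 0)
          then (if r = 0 \<or> r = i then 1 / 2 else 0) else 0)"
      using i that by (intro sum.cong refl) (auto simp: star_mat_entry power_divide)
    then show ?thesis using i by (auto simp del: sum.lessThan_Suc)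
  qed
  then have "(\<Sum>r<n + 1. \<Sum>c<n + 1. (star_mat n i $$ (r, c))\<^sup>2) =
      (\<Sum>r<n + 1. (if r = 0 then 1 / 2 else 0) + (if r = i then 1 / 2 else 0))"
    by (intro sum.cong refl) auto
  also have "\<dots> = 1" unfolding sum.distrib using i by (simp del: sum.lessThan_Suc)
  finally show ?thesis by (simp add: frob_norm_def del: sum.lessThan_Suc)
qed

section \<open>Conclusions\<close>

lemma nu_star_mat_bounds:
  assumes n: "1 \<le> n"
  shows "(sqrt (real n) - 1)\<^sup>2 / 2 \<le> nu (n + 1) (star_mat n) {1..n}"
    and "nu (n + 1) (star_mat n) {1..n} \<le> real n / 2"
proof -
  obtain V where V: "V \<in> orthogonal_group (n + 1)"
    "nu (n + 1) (star_mat n) {1..n} = op_norm (pinching_defect (n + 1) (star_mat n) {1..n} V)"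
    and le: "\<And>U. U \<in> orthogonal_group (n + 1) \<Longrightarrow>
      nu (n + 1) (star_mat n) {1..n} \<le> op_norm (pinching_defect (n + 1) (star_mat n) {1..n} U)"
    using nu_attained[of "{1..n}" "star_mat n" "n + 1"] star_mat_carrier by blast
  show "(sqrt (real n) - 1)\<^sup>2 / 2 \<le> nu (n + 1) (star_mat n) {1..n}"
    using pinching_defect_lower_bound[OF n V(1)] V(2) by simp
  show "nu (n + 1) (star_mat n) {1..n} \<le> real n / 2"
    using le[OF one_mat_orthogonal] op_norm_pinching_defect_one[OF n] by linarith
qed

lemma signings_nonempty: "signings n \<noteq> {}"
  by (simp add: signings_def PiE_eq_empty_iff)

text \<open>All signings of the star matrices give the same norm \<open>sqrt (n / 2)\<close>, so the minimum over the
  signings is this number, and it exceeds \<open>K\<close> as soon as \<open>n > 2 K\<^sup>2\<close>.\<close>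
lemma no_frobenius_komlos_constant:
  "\<not> (\<exists>K::real. \<forall>(d::nat) (n::nat) (B :: nat \<Rightarrow> real mat).
        1 \<le> d \<and> 1 \<le> n \<and> (\<forall>i\<in>{1..n}. B i \<in> sym_mats d) \<and> (MAX i\<in>{1..n}. frob_norm (B i)) \<le> 1
        \<longrightarrow> (MIN s\<in>signings n. op_norm (signed_sum d n s B)) \<le> K)"
proof
  assume "\<exists>K::real. \<forall>(d::nat) (n::nat) (B :: nat \<Rightarrow> real mat).
        1 \<le> d \<and> 1 \<le> n \<and> (\<forall>i\<in>{1..n}. B i \<in> sym_mats d) \<and> (MAX i\<in>{1..n}. frob_norm (B i)) \<le> 1
        \<longrightarrow> (MIN s\<in>signings n. op_norm (signed_sum d n s B)) \<le> K"
  then obtain K :: real where K: "\<And>d n (B :: nat \<Rightarrow> real mat).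
      1 \<le> d \<Longrightarrow> 1 \<le> n \<Longrightarrow> \<forall>i\<in>{1..n}. B i \<in> sym_mats d \<Longrightarrow>
      (MAX i\<in>{1..n}. frob_norm (B i)) \<le> 1 \<Longrightarrow>
      (MIN s\<in>signings n. op_norm (signed_sum d n s B)) \<le> K"
    by blast
  obtain n :: nat where big: "max 1 (2 * K\<^sup>2) < real n" using reals_Archimedean2 by blast
  then have n: "1 \<le> n" by simp
  have "(\<lambda>i. frob_norm (star_mat n i)) ` {1..n} = {1}"
    using n by (force simp: frob_norm_star_mat)
  then have frob: "(MAX i\<in>{1..n}. frob_norm (star_mat n i)) \<le> 1" by simp
  have sym: "\<forall>i\<in>{1..n}. star_mat n i \<in> sym_mats (n + 1)"
  proof
    fix i assume "i \<in> {1..n}"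
    then show "star_mat n i \<in> sym_mats (n + 1)" by (intro star_mat_sym) auto
  qed
  have "(MIN s\<in>signings n. op_norm (signed_sum (n + 1) n s (star_mat n))) \<le> K"
    by (rule K[OF _ n sym frob]) simp
  moreover have "(\<lambda>s. op_norm (signed_sum (n + 1) n s (star_mat n))) ` signings n = {sqrt (real n / 2)}"
    using signings_nonempty[of n] op_norm_signed_sum_star_mat by auto
  ultimately have "sqrt (real n / 2) \<le> K" by simp
  then have "real n / 2 \<le> K\<^sup>2" by (rule sqrt_le_D)
  with big show False by simp
qed

theorem proposition4p3:
  shows "(\<forall>n::nat. 1 \<le> n \<longrightarrow>
      (\<forall>s \<in> signings n. op_norm (signed_sum (n + 1) n s (star_mat n)) = sqrt (real n / 2)) \<and>
      (sqrt (real n) - 1)\<^sup>2 / 2 \<le> nu (n + 1) (star_mat n) {1..n} \<and>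
      nu (n + 1) (star_mat n) {1..n} \<le> real n / 2)
    \<and> \<not> (\<exists>K::real. \<forall>(d::nat) (n::nat) (B :: nat \<Rightarrow> real mat).
        1 \<le> d \<and> 1 \<le> n \<and> (\<forall>i\<in>{1..n}. B i \<in> sym_mats d) \<and> (MAX i\<in>{1..n}. frob_norm (B i)) \<le> 1
        \<longrightarrow> (MIN s\<in>signings n. op_norm (signed_sum d n s B)) \<le> K)"
  using op_norm_signed_sum_star_mat nu_star_mat_bounds no_frobenius_komlos_constant by blast

end
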